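(* Let $p$ be a prime, let $S$ be a subset of $\mathbb{F}_p$ with size at least $2$, and let $1 \le r \le p-1$ be an integer. Then there exists some $a=a(p,S,r)>0$ such that the following holds. If $n \ge 1$ and $k \ge 1$ are integers, $E_1, \dots, E_k$ are strict subsets of $\mathbb{F}_p$ each with size at most $r$, and $\phi_1, \dots, \phi_k: \mathbb{F}_p^n \to \mathbb{F}_p$ are linear forms satisfying \[|Z(\phi_j - \phi_i)| \ge 2 \left\lfloor \frac{r-1}{|S|-1} \right\rfloor + 1\] for any $1 \le i < j \le k$, then the density (inside $S^n$) of points $x \in S^n$ satisfying \[\phi_1(x) \in E_1, \dots, \phi_k(x) \in E_k\] is at most $O(k^{-a/ \log \log k})$ as $k$ tends to infinity. Here the $O$ is uniform in $n$, the $E_i$ and the $\phi_i$: there exist constants $C>0$ and $k_0 \ge 3$ depending only on $p$, $S$ and $r$ such that for all $k \ge k_0$ and all such $n$, $E_i$, $\phi_i$ the density is at most $C k^{-a/\log\log k}$.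
   Context: For a linear form $\phi: \mathbb{F}_p^n \to \mathbb{F}_p$ (also called a mod-$p$ form), $\phi(x) = a_1 x_1 + \dots + a_n x_n$, the support is $Z(\phi) = \{i \in \{1,\dots,n\}: a_i \neq 0\}$. A strict subset of $\mathbb{F}_p$ is a subset different from $\mathbb{F}_p$. The density of a subset $A \subset S^n$ inside $S^n$ is $|A|/|S|^n$. $\log$ is the natural logarithm. *)

theory Defs
  imports Complex_Main "HOL-Library.FuncSet" "Berlekamp_Zassenhaus.Finite_Field"
begin

text \<open>
  The field with \<open>p\<close> elements is \<open>'p mod_ring\<close>, where \<open>'p :: prime_card\<close> is a type with
  \<open>p = CARD('p)\<close> elements. The power \<open>S\<close> to the \<open>n\<close> of a set \<open>S\<close> is the set of extensional functions
  \<open>{1..n} \<rightarrow>\<^sub>E S\<close>; in particular the space on which forms live is \<open>{1..n} \<rightarrow>\<^sub>E UNIV\<close>. Only the values of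
  a form on that space are meaningful.
\<close>

definition linear_form :: "nat \<Rightarrow> ((nat \<Rightarrow> 'a::comm_ring_1) \<Rightarrow> 'a) \<Rightarrow> bool" where
  "linear_form n \<phi> \<longleftrightarrow> (\<exists>a. \<forall>x \<in> {1..n} \<rightarrow>\<^sub>E UNIV. \<phi> x = (\<Sum>i=1..n. a i * x i))"

text \<open>
  The coefficient \<open>a i\<close> of a linear form is its value at the \<open>i\<close>-th standard basis vector.
  Lemma \<open>form_support_eq\<close> below confirms that the support is the set of indices of nonzero
  coefficients.
\<close>

definition form_coeff :: "nat \<Rightarrow> ((nat \<Rightarrow> 'a::comm_ring_1) \<Rightarrow> 'a) \<Rightarrow> nat \<Rightarrow> 'a" where
  "form_coeff n \<phi> i = \<phi> (\<lambda>j\<in>{1..n}. if j = i then 1 else 0)"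

definition form_support :: "nat \<Rightarrow> ((nat \<Rightarrow> 'a::comm_ring_1) \<Rightarrow> 'a) \<Rightarrow> nat set" where
  "form_support n \<phi> = {i \<in> {1..n}. form_coeff n \<phi> i \<noteq> 0}"

lemma form_coeff_eq:
  fixes \<phi> :: "(nat \<Rightarrow> 'a::comm_ring_1) \<Rightarrow> 'a"
  assumes "\<forall>x \<in> {1..n} \<rightarrow>\<^sub>E UNIV. \<phi> x = (\<Sum>i=1..n. a i * x i)" and "i \<in> {1..n}"
  shows "form_coeff n \<phi> i = a i"
proof -
  have "form_coeff n \<phi> i = (\<Sum>j=1..n. a j * (\<lambda>j\<in>{1..n}. if j = i then 1 else 0) j)"
    unfolding form_coeff_def by (rule assms(1)[rule_format]) auto
  also have "\<dots> = (\<Sum>j=1..n. if j = i then a j else 0)"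
    by (rule sum.cong) auto
  also have "\<dots> = a i"
    using assms(2) by simp
  finally show ?thesis .
qed

lemma form_support_eq:
  fixes \<phi> :: "(nat \<Rightarrow> 'a::comm_ring_1) \<Rightarrow> 'a"
  assumes "\<forall>x \<in> {1..n} \<rightarrow>\<^sub>E UNIV. \<phi> x = (\<Sum>i=1..n. a i * x i)"
  shows "form_support n \<phi> = {i \<in> {1..n}. a i \<noteq> 0}"
  using form_coeff_eq[OF assms] by (auto simp: form_support_def)

definition density_in_power :: "'a set \<Rightarrow> nat \<Rightarrow> (nat \<Rightarrow> 'a) set \<Rightarrow> real" where
  "density_in_power S n A = real (card A) / real (card S) ^ n"

end

theory Submission
  imports Defs "HOL-Library.Set_Algebras" "HOL-Library.Real_Mod"
begin

text \<open>
  Write \<open>s\<close> for the size of \<open>S\<close> and \<open>d = (r - 1) div (s - 1)\<close>, and identify a form with its vector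
  of coefficients. It suffices to find, among the \<open>k\<close> conditions, about \<open>T = c log k / log log k\<close>
  that are essentially independent: the density is then exponentially small in \<open>T\<close>, which is
  \<open>k powr (- a / log log k)\<close>. There are two ways in which this can happen, and
  \<open>spread_or_concentrated\<close> shows that one of them always does.
  
  Either there are \<open>T\<close> forms all of whose nontrivial linear combinations have support larger than
  \<open>C T\<close>. With \<open>C\<close> large, Fourier analysis (\<open>card_fibre_spread\<close>) shows that on the power
  of \<open>S\<close> no tuple of values of the forms is more than a constant factor likelier than under the
  uniform distribution, so the density is at most a constant times \<open>(r / p) ^ T\<close>.
  
  Or every form differs in at most \<open>C T\<close> coordinates from the span of at most \<open>T\<close> of them. The
  span has at most \<open>p ^ T\<close> elements, so many forms are close to the same one, and their
  differences with it are vectors of weight at most \<open>C T\<close>. The sunflower lemma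
  (\<open>vector_sunflower\<close>) loses a factor like \<open>(C T) ^ (O (C T))\<close>, which is a small power of \<open>k\<close> by the
  choice of \<open>T\<close>; it provides \<open>T + 1\<close> forms that are the sum of a common form and of parts with
  disjoint supports. As two forms differ in at least \<open>2 d + 1\<close> coordinates, all these parts but one
  have support at least \<open>d + 1\<close>. By the Cauchy--Davenport theorem such a part takes at least
  \<open>min p ((d + 1) (s - 1) + 1) > r\<close> values on the power of \<open>S\<close>. Hence, for each of the \<open>p\<close> values of
  the common form, each condition fails with probability at least \<open>1 / s ^ (d + 1)\<close>, independently
  (\<open>card_avoiding_disjoint_blocks\<close>).
\<close>

definition form :: "'i set \<Rightarrow> ('i \<Rightarrow> 'a::comm_ring_1) \<Rightarrow> ('i \<Rightarrow> 'a) \<Rightarrow> 'a" where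
  "form I c x = (\<Sum>i\<in>I. c i * x i)"

definition supp :: "'i set \<Rightarrow> ('i \<Rightarrow> 'a::zero) \<Rightarrow> 'i set" where
  "supp I c = {i \<in> I. c i \<noteq> 0}"

section \<open>The Cauchy--Davenport theorem and the range of a form\<close>

text \<open>
  As the field is prime, the multiples \<open>n d\<close> by natural numbers exhaust it.
\<close>

lemma translation_invariant_UNIV:
  fixes A :: "'p::prime_card mod_ring set"
  assumes "A \<noteq> {}" "d \<noteq> 0" and inv: "\<And>a. a \<in> A \<Longrightarrow> a + d \<in> A"
  shows "A = UNIV"
proof -
  obtain a where a: "a \<in> A" using assms by auto
  have step: "a + of_nat n * d \<in> A" for n
  proof (induction n)
    case (Suc n)
    have "a + of_nat (Suc n) * d = (a + of_nat n * d) + d" by (simp add: distrib_right add_ac)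
    thus ?case using inv[OF Suc] by (simp only:)
  qed (use a in simp)
  have "y \<in> A" for y
  proof -
    obtain n where "(y - a) / d = of_nat n" using surj_of_nat_mod_ring by blast
    hence "y = a + of_nat n * d" using \<open>d \<noteq> 0\<close> by (simp add: field_simps)
    thus ?thesis using step by simp
  qed
  thus ?thesis by auto
qed

text \<open>
  Induction on the size of \<open>B\<close> by Davenport's transform. Unless \<open>A\<close> is everything, it is not
  invariant under the translation by a nonzero difference of two elements of \<open>B\<close>, so some
  translate \<open>B\<^sub>1\<close> of \<open>B\<close> meets \<open>A\<close> without lying inside it. Replacing \<open>(A, B)\<close> by
  \<open>(A \<union> B\<^sub>1, A \<inter> B\<^sub>1)\<close> preserves the sum of the sizes, makes the second set smaller, and does not
  enlarge the sumset up to translation.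
\<close>

theorem cauchy_davenport:
  fixes A B :: "'p::prime_card mod_ring set"
  assumes "A \<noteq> {}" "B \<noteq> {}"
  shows "min CARD('p) (card A + card B - 1) \<le> card (A + B)"
  using assms
proof (induction "card B" arbitrary: A B rule: less_induct)
  case less
  show ?case
  proof (cases "A = UNIV")
    case True
    obtain b where "b \<in> B" using less by auto
    hence "(\<lambda>a. a + b) ` A \<subseteq> A + B" by auto
    hence "card ((\<lambda>a. a + b) ` A) \<le> card (A + B)" by (intro card_mono) auto
    hence "card A \<le> card (A + B)" by (simp add: card_image inj_on_def)
    thus ?thesis using True by simp
  next
    case False
    show ?thesis
    proof (cases "card B = 1")
      case True
      then obtain b where "B = {b}" by (meson card_1_singletonE)
      hence "(\<lambda>a. a + b) ` A \<subseteq> A + B" by auto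
      hence "card ((\<lambda>a. a + b) ` A) \<le> card (A + B)" by (intro card_mono) auto
      hence "card A \<le> card (A + B)" by (simp add: card_image inj_on_def)
      thus ?thesis using True by simp
    next
      case False
      have "card B \<noteq> 0" using less by simp
      hence "1 < card B" using False by linarith
      then obtain b b' where b: "b \<in> B" "b' \<in> B" "b \<noteq> b'"
        by (metis card_le_Suc0_iff_eq finite One_nat_def not_le)
      have "\<exists>a\<in>A. a + (b' - b) \<notin> A"
        using translation_invariant_UNIV[of A "b' - b"] b less \<open>A \<noteq> UNIV\<close> by force
      then obtain a where a: "a \<in> A" "a + (b' - b) \<notin> A" by auto
      define B1 where "B1 = (\<lambda>x. x + (a - b)) ` B"
      have cB1: "card B1 = card B" unfolding B1_def by (simp add: card_image inj_on_def)
      have "a \<in> B1" unfolding B1_def using b by (intro image_eqI[of _ _ b]) auto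
      moreover have "a + (b' - b) \<in> B1" unfolding B1_def using b by (intro image_eqI[of _ _ b']) auto
      ultimately have ne: "A \<inter> B1 \<noteq> {}" and "A \<inter> B1 \<subset> B1" using a by auto
      hence lt: "card (A \<inter> B1) < card B" using cB1 by (metis finite psubset_card_mono)
      have "min CARD('p) (card (A \<union> B1) + card (A \<inter> B1) - 1) \<le> card ((A \<union> B1) + (A \<inter> B1))"
        by (rule less.hyps) (use lt ne in auto)
      also have "\<dots> \<le> card ((\<lambda>x. x + (a - b)) ` (A + B))"
      proof (intro card_mono subsetI)
        fix x assume "x \<in> (A \<union> B1) + (A \<inter> B1)"
        then obtain u v where uv: "x = u + v" "u \<in> A \<union> B1" "v \<in> A \<inter> B1" by (auto elim: set_plus_elim)
        then obtain u' v' where "x = u' + v'" "u' \<in> A" "v' \<in> B1"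
          by (metis IntD1 IntD2 Un_iff add.commute)
        then obtain w where "w \<in> B" "x = (u' + w) + (a - b)" "u' \<in> A"
          unfolding B1_def by (auto simp: add.assoc)
        thus "x \<in> (\<lambda>x. x + (a - b)) ` (A + B)" by blast
      qed auto
      also have "\<dots> = card (A + B)" by (simp add: card_image inj_on_def)
      also have "card (A \<union> B1) + card (A \<inter> B1) = card A + card B"
        using card_Un_Int[of A B1] cB1 by simp
      finally show ?thesis .
    qed
  qed
qed

text \<open>
  The range is the sumset of the dilates \<open>c i \<cdot> S\<close>, each of which has as many elements as \<open>S\<close>.
\<close>

lemma card_range_form:
  fixes S :: "'p::prime_card mod_ring set"
  assumes "finite W" "S \<noteq> {}" "\<And>i. i \<in> W \<Longrightarrow> c i \<noteq> 0"
  shows "min CARD('p) (card W * (card S - 1) + 1) \<le> card (form W c ` (W \<rightarrow>\<^sub>E S))"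
  using assms(1,3)
proof (induction W rule: finite_induct)
  case empty
  show ?case by (simp add: form_def)
next
  case (insert w W)
  let ?A = "form W c ` (W \<rightarrow>\<^sub>E S)" and ?B = "(\<lambda>s. c w * s) ` S"
  have cB: "card ?B = card S"
    using insert.prems[of w] by (simp add: card_image inj_on_def)
  have S0: "card S \<noteq> 0" using assms by simp
  have "?A + ?B \<subseteq> form (insert w W) c ` (insert w W \<rightarrow>\<^sub>E S)"
  proof
    fix y assume "y \<in> ?A + ?B"
    then obtain x s where xs: "x \<in> W \<rightarrow>\<^sub>E S" "s \<in> S" "y = form W c x + c w * s"
      by (auto elim!: set_plus_elim)
    have "form W c (x(w := s)) = form W c x"
      unfolding form_def using insert.hyps by (intro sum.cong) auto
    hence "y = form (insert w W) c (x(w := s))"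
      using insert.hyps xs by (simp add: form_def add.commute)
    moreover have "x(w := s) \<in> insert w W \<rightarrow>\<^sub>E S" using xs by (intro PiE_fun_upd) auto
    ultimately show "y \<in> form (insert w W) c ` (insert w W \<rightarrow>\<^sub>E S)" by blast
  qed
  hence "card (?A + ?B) \<le> card (form (insert w W) c ` (insert w W \<rightarrow>\<^sub>E S))"
    by (intro card_mono) auto
  moreover have "min CARD('p) (card ?A + card ?B - 1) \<le> card (?A + ?B)"
    by (rule cauchy_davenport) (use assms(2) in \<open>auto simp: PiE_eq_empty_iff\<close>)
  moreover have "min CARD('p) (card W * (card S - 1) + 1) \<le> card ?A"
    using insert by auto
  moreover have "card (insert w W) * (card S - 1) = card W * (card S - 1) + (card S - 1)"
    using insert.hyps by simp
  ultimately show ?case using cB S0 by linarith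
qed

text \<open>
  This is where the size of the support matters: as soon as \<open>card W * (card S - 1)\<close> reaches the
  size of \<open>E\<close>, no choice of the other coordinates (which contribute the constant \<open>y\<close>) can force
  the value of the form into \<open>E\<close>.
\<close>

lemma form_avoids_small_set:
  fixes S E :: "'p::prime_card mod_ring set"
  assumes "finite W" "S \<noteq> {}" "\<And>i. i \<in> W \<Longrightarrow> c i \<noteq> 0"
    and "card E < CARD('p)" "card E \<le> card W * (card S - 1)"
  shows "\<exists>x \<in> W \<rightarrow>\<^sub>E S. form W c x + y \<notin> E"
proof (rule ccontr)
  assume "\<not> ?thesis"
  hence "(\<lambda>v. v + y) ` (form W c ` (W \<rightarrow>\<^sub>E S)) \<subseteq> E" by auto
  hence "card ((\<lambda>v. v + y) ` (form W c ` (W \<rightarrow>\<^sub>E S))) \<le> card E" by (intro card_mono) auto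
  hence "card (form W c ` (W \<rightarrow>\<^sub>E S)) \<le> card E" by (simp add: card_image inj_on_def)
  moreover have "min CARD('p) (card W * (card S - 1) + 1) \<le> card (form W c ` (W \<rightarrow>\<^sub>E S))"
    by (rule card_range_form) (use assms in auto)
  ultimately show False using assms(4,5) by linarith
qed

section \<open>Forms that escape on disjoint blocks of coordinates\<close>

text \<open>
  In terms of probability, the conclusion bounds the density by \<open>(1 - 1 / s^m) ^ card J\<close> with \<open>s\<close>
  the size of \<open>S\<close>. The reason is independence: once the coordinates outside the block \<open>W j\<close> are
  fixed, at least one of the \<open>s^m\<close> assignments of the block violates the condition on the form \<open>\<eta> j\<close>,
  and the conditions on the other forms do not see that block. The induction removes one block
  at a time.
\<close>

lemma card_avoiding_disjoint_blocks:
  fixes S :: "'a::comm_ring_1 set"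
  assumes "finite J" "finite I" "finite S"
    and "\<And>j. j \<in> J \<Longrightarrow> W j \<subseteq> I" "\<And>j. j \<in> J \<Longrightarrow> card (W j) = m"
    and "\<And>i j l. i \<in> J \<Longrightarrow> j \<in> J \<Longrightarrow> i \<noteq> j \<Longrightarrow> l \<in> W i \<Longrightarrow> l \<notin> W j \<and> \<eta> j l = 0"
    and "\<And>j y. j \<in> J \<Longrightarrow> \<exists>x \<in> W j \<rightarrow>\<^sub>E S. form (W j) (\<eta> j) x + y \<notin> E j"
  shows "card {x \<in> I \<rightarrow>\<^sub>E S. \<forall>j\<in>J. form I (\<eta> j) x \<in> E j} * card S ^ (m * card J)
           \<le> (card S ^ m - 1) ^ card J * card S ^ card I"
  using assms(1,2,4-)
proof (induction J arbitrary: I rule: finite_induct)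
  case empty
  thus ?case by (simp add: card_funcsetE)
next
  case (insert j J)
  define I' where "I' = I - W j"
  have WI: "W j \<subseteq> I" and cW: "card (W j) = m" using insert.prems by auto
  have fW: "finite (W j)" using WI insert.prems(1) by (rule finite_subset)
  have mI: "m \<le> card I" using card_mono[OF insert.prems(1) WI] cW by simp
  have cI': "card I' = card I - m" unfolding I'_def using WI cW fW by (simp add: card_Diff_subset)
  have I: "I = I' \<union> W j" "I' \<inter> W j = {}" "finite I'" using WI insert.prems(1) unfolding I'_def by auto
  have split: "form I c x = form I' c (restrict x I') + form (W j) c (restrict x (W j))" for c and x :: "_ \<Rightarrow> 'a"
    unfolding form_def I(1) using I fW by (subst sum.union_disjoint) (auto intro!: arg_cong2[of _ _ _ _ "(+)"] sum.cong)
  define A where "A = {x \<in> I' \<rightarrow>\<^sub>E S. \<forall>j\<in>J. form I' (\<eta> j) x \<in> E j}"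
  define B where "B y = {z \<in> W j \<rightarrow>\<^sub>E S. form I' (\<eta> j) y + form (W j) (\<eta> j) z \<in> E j}" for y
  have finW: "finite (W j \<rightarrow>\<^sub>E S)" and finI': "finite (I' \<rightarrow>\<^sub>E S)"
    using fW I assms(3) by (auto intro: finite_PiE)
  have finB: "finite (B y)" for y unfolding B_def using finW by auto
  have finA: "finite A" unfolding A_def using finI' by auto
  have cB: "card (B y) \<le> card S ^ m - 1" for y
  proof -
    obtain z where z: "z \<in> W j \<rightarrow>\<^sub>E S" "form (W j) (\<eta> j) z + form I' (\<eta> j) y \<notin> E j"
      using insert.prems(5)[of j] by blast
    hence "B y \<subseteq> (W j \<rightarrow>\<^sub>E S) - {z}" unfolding B_def by (auto simp: add.commute)
    hence "card (B y) \<le> card ((W j \<rightarrow>\<^sub>E S) - {z})" using finW by (intro card_mono) auto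
    also have "\<dots> = card S ^ m - 1" using z fW cW by (simp add: card_funcsetE)
    finally show ?thesis .
  qed
  let ?X = "{x \<in> I \<rightarrow>\<^sub>E S. \<forall>j\<in>insert j J. form I (\<eta> j) x \<in> E j}"
  let ?f = "\<lambda>x::_ \<Rightarrow> 'a. (restrict x I', restrict x (W j))"
  have "inj_on ?f ?X"
  proof (rule inj_onI)
    fix x y assume xy: "x \<in> ?X" "y \<in> ?X" "?f x = ?f y"
    have "x i = y i" if "i \<in> I" for i
      using xy(3) that I(1) by (metis (no_types, lifting) Un_iff prod.inject restrict_apply')
    thus "x = y" using xy by (intro PiE_ext[of x I "\<lambda>_. S" y]) auto
  qed
  moreover have "?f ` ?X \<subseteq> Sigma A B"
  proof
    fix q assume "q \<in> ?f ` ?X"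
    then obtain x where x: "x \<in> ?X" "q = ?f x" by auto
    have "form I (\<eta> i) x = form I' (\<eta> i) (restrict x I')" if "i \<in> J" for i
    proof -
      have "form (W j) (\<eta> i) (restrict x (W j)) = 0"
        unfolding form_def using insert.prems(4)[of j i] that insert.hyps by (intro sum.neutral ballI) (metis insertCI mult_zero_left)
      thus ?thesis by (simp add: split)
    qed
    moreover have "restrict x I' \<in> I' \<rightarrow>\<^sub>E S" "restrict x (W j) \<in> W j \<rightarrow>\<^sub>E S" using x I(1) by auto
    moreover have "form I' (\<eta> j) (restrict x I') + form (W j) (\<eta> j) (restrict x (W j)) \<in> E j"
      using x by (simp flip: split)
    ultimately show "q \<in> Sigma A B" unfolding A_def B_def using x by auto
  qed
  ultimately have "card ?X \<le> card (Sigma A B)"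
    using finA finB by (intro card_inj_on_le) auto
  also have "\<dots> = (\<Sum>y\<in>A. card (B y))" using finA finB by simp
  also have "\<dots> \<le> card A * (card S ^ m - 1)" using sum_bounded_above[of A "\<lambda>y. card (B y)"] cB by auto
  finally have X: "card ?X \<le> card A * (card S ^ m - 1)" .
  have "J \<subseteq> insert j J" by auto
  have IH: "card A * card S ^ (m * card J) \<le> (card S ^ m - 1) ^ card J * card S ^ card I'"
    unfolding A_def
  proof (rule insert.IH)
    fix i assume i: "i \<in> J"
    hence "i \<noteq> j" using insert.hyps by auto
    thus "W i \<subseteq> I'" unfolding I'_def using insert.prems(2)[of i] insert.prems(4)[of i j] i by auto
    show "card (W i) = m" using insert.prems(3)[of i] i by blast
    show "\<exists>x\<in>W i \<rightarrow>\<^sub>E S. form (W i) (\<eta> i) x + y \<notin> E i" for y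
      using insert.prems(5)[of i y] i by blast
  next
    fix i i' l assume "i \<in> J" "i' \<in> J" "i \<noteq> i'" "l \<in> W i"
    thus "l \<notin> W i' \<and> \<eta> i' l = 0" using insert.prems(4)[of i i' l] by blast
  qed (rule I(3))
  have "card ?X * card S ^ (m * card (insert j J)) \<le> card A * (card S ^ m - 1) * card S ^ (m * card (insert j J))"
    using X by (rule mult_right_mono) simp
  also have "\<dots> = (card A * card S ^ (m * card J)) * ((card S ^ m - 1) * card S ^ m)"
    using insert.hyps by (simp add: power_add algebra_simps)
  also have "\<dots> \<le> ((card S ^ m - 1) ^ card J * card S ^ card I') * ((card S ^ m - 1) * card S ^ m)"
    using IH by (rule mult_right_mono) simp
  also have "\<dots> = (card S ^ m - 1) ^ card (insert j J) * (card S ^ card I' * card S ^ m)"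
    using insert.hyps by simp
  also have "card S ^ card I' * card S ^ m = card S ^ card I"
    using mI by (simp add: cI' flip: power_add)
  finally show ?case .
qed

section \<open>A sunflower lemma for vectors\<close>

lemma card_le_fibres:
  assumes "finite A" "finite B" "f ` A \<subseteq> B" "\<And>y. y \<in> B \<Longrightarrow> card {x \<in> A. f x = y} \<le> N"
  shows "card A \<le> card B * N"
proof -
  have "A = (\<Union>y\<in>B. {x \<in> A. f x = y})" using assms(3) by auto
  hence "card A \<le> (\<Sum>y\<in>B. card {x \<in> A. f x = y})"
    using card_UN_le[OF assms(2), of "\<lambda>y. {x \<in> A. f x = y}"] by simp
  also have "\<dots> \<le> card B * N" using sum_bounded_above[of B _ N] assms(4) by auto
  finally show ?thesis .
qed

text \<open>
  A version for vectors of the Erdos--Rado sunflower lemma, with the kernel replaced by a vector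
  \<open>\<chi>\<close> whose subtraction makes the supports disjoint. If a maximal subfamily with disjoint supports
  has fewer than \<open>t\<close> members, then its supports cover a set \<open>U\<close> of at most \<open>t w\<^sub>0\<close> coordinates
  which every nonzero vector of the family meets. Hence a proportion of the vectors share the
  same nonzero value \<open>a\<close> at the same coordinate; making that entry zero lowers their weight, and
  the induction on the weight \<open>w\<close> applies. The separate bound \<open>w\<^sub>0\<close> keeps the base of the power
  constant during the induction.
\<close>

lemma vector_sunflower:
  fixes v :: "'k \<Rightarrow> 'i \<Rightarrow> 'a::{finite, ab_group_add}"
  assumes "finite K" "finite I" "1 \<le> t" "w \<le> w0"
    and "\<And>j. j \<in> K \<Longrightarrow> card (supp I (v j)) \<le> w"
    and "\<And>i j. i \<in> K \<Longrightarrow> j \<in> K \<Longrightarrow> i \<noteq> j \<Longrightarrow> \<exists>l\<in>I. v i l \<noteq> v j l"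
    and "(t * w0 * CARD('a)) ^ w < card K"
  shows "\<exists>\<chi> J. J \<subseteq> K \<and> card J = t \<and>
    (\<forall>i\<in>J. \<forall>j\<in>J. i \<noteq> j \<longrightarrow> supp I (\<lambda>l. v i l - \<chi> l) \<inter> supp I (\<lambda>l. v j l - \<chi> l) = {})"
  using assms(1,4-)
proof (induction w arbitrary: K v)
  case 0
  hence "1 < card K" by simp
  then obtain i j where ij: "i \<in> K" "j \<in> K" "i \<noteq> j"
    by (metis card_le_Suc0_iff_eq One_nat_def not_le "0.prems"(1))
  have "v i l = 0 \<and> v j l = 0" if "l \<in> I" for l
    using "0.prems"(3)[OF ij(1)] "0.prems"(3)[OF ij(2)] that assms(2) by (auto simp: supp_def)
  thus ?case using "0.prems"(4)[OF ij] by auto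
next
  case (Suc w)
  define D where "D J \<longleftrightarrow> J \<subseteq> K \<and> (\<forall>i\<in>J. \<forall>j\<in>J. i \<noteq> j \<longrightarrow> supp I (v i) \<inter> supp I (v j) = {})" for J
  define Js where "Js = {J. D J}"
  have "Js \<subseteq> Pow K" by (auto simp: Js_def D_def)
  hence "finite Js" using Suc.prems(1) finite_subset by blast
  moreover have "{} \<in> Js" by (auto simp: Js_def D_def)
  ultimately obtain J where J: "J \<in> Js" and Jmax: "\<And>J'. J' \<in> Js \<Longrightarrow> J \<subseteq> J' \<Longrightarrow> J = J'"
    using finite_has_maximal[of Js] by blast
  have DJ: "D J" using J by (simp add: Js_def)
  have JK: "J \<subseteq> K" and fJ: "finite J" using DJ Suc.prems(1) finite_subset by (auto simp: D_def)
  show ?case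
  proof (cases "t \<le> card J")
    case True
    then obtain J' where "J' \<subseteq> J" "card J' = t" using obtain_subset_with_card_n by metis
    moreover have "supp I (v i) \<inter> supp I (v j) = {}" if "i \<in> J'" "j \<in> J'" "i \<noteq> j" for i j
      using DJ that \<open>J' \<subseteq> J\<close> unfolding D_def by blast
    ultimately show ?thesis using JK by (intro exI[of _ "\<lambda>_. 0"] exI[of _ J']) auto
  next
    case False
    define U where "U = (\<Union>j\<in>J. supp I (v j))"
    have fsupp: "finite (supp I c)" for c :: "'i \<Rightarrow> 'a" using assms(2) by (simp add: supp_def)
    have fU: "finite U" unfolding U_def using fJ fsupp by auto
    have "card U \<le> (\<Sum>j\<in>J. card (supp I (v j)))" unfolding U_def by (rule card_UN_le[OF fJ])
    also have "\<dots> \<le> card J * Suc w"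
      using sum_bounded_above[of J "\<lambda>j. card (supp I (v j))" "Suc w"] Suc.prems(3) JK by auto
    also have "\<dots> \<le> t * w0" using False Suc.prems(2) by (intro mult_le_mono) auto
    finally have cU: "card U \<le> t * w0" .
    define N where "N = (t * w0 * CARD('a)) ^ w"
    \<comment> \<open>The zero vector meets no support and is the only member of the family that needs separate treatment.\<close>
    define Z where "Z = {i \<in> K. supp I (v i) = {}}"
    have "card Z \<le> 1"
    proof -
      have "i = j" if "i \<in> Z" "j \<in> Z" for i j
        using Suc.prems(4)[of i j] that by (force simp: Z_def supp_def)
      moreover have "finite Z" using Suc.prems(1) by (simp add: Z_def)
      ultimately show ?thesis using card_le_Suc0_iff_eq[of Z] by auto
    qed
    define F where "F q = {i \<in> K. v i (fst q) = snd q}" for q :: "'i \<times> 'a"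
    have cover: "K \<subseteq> Z \<union> (\<Union>q\<in>U \<times> (UNIV - {0}). F q)"
    proof
      fix i assume i: "i \<in> K"
      show "i \<in> Z \<union> (\<Union>q\<in>U \<times> (UNIV - {0}). F q)"
      proof (cases "i \<in> Z")
        case nz: False
        have "supp I (v i) \<inter> U \<noteq> {}"
        proof
          assume e: "supp I (v i) \<inter> U = {}"
          hence "D (insert i J)" using DJ i by (auto simp: D_def U_def)
          hence "i \<in> J" using Jmax[of "insert i J"] by (auto simp: Js_def)
          thus False using e nz i by (auto simp: U_def Z_def)
        qed
        then obtain l where "l \<in> U" "v i l \<noteq> 0" by (auto simp: supp_def)
        thus ?thesis using i by (auto simp: F_def intro!: bexI[of _ "(l, v i l)"])
      qed auto
    qed
    have "\<exists>q\<in>U \<times> (UNIV - {0}). N < card (F q)"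
    proof (rule ccontr)
      assume "\<not> ?thesis"
      hence small: "card (F q) \<le> N" if "q \<in> U \<times> (UNIV - {0})" for q using that by force
      have "finite (F q)" for q unfolding F_def using Suc.prems(1) by auto
      hence "card K \<le> card (Z \<union> (\<Union>q\<in>U \<times> (UNIV - {0}). F q))"
        using cover fU Suc.prems(1) by (intro card_mono) (auto simp: Z_def)
      also have "\<dots> \<le> card Z + card (\<Union>q\<in>U \<times> (UNIV - {0}). F q)" by (rule card_Un_le)
      also have "card (\<Union>q\<in>U \<times> (UNIV - {0}). F q) \<le> (\<Sum>q\<in>U \<times> (UNIV - {0}). card (F q))"
        using fU by (intro card_UN_le) auto
      also have "\<dots> \<le> card (U \<times> (UNIV - {0::'a})) * N"
        using sum_bounded_above[of "U \<times> (UNIV - {0::'a})" "\<lambda>q. card (F q)" N] small by auto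
      also have "\<dots> = card U * (CARD('a) - 1) * N" by (simp add: card_cartesian_product)
      also have "\<dots> \<le> (t * w0) * (CARD('a) - 1) * N" using cU by (intro mult_le_mono) auto
      finally have "card K \<le> 1 + (t * w0) * (CARD('a) - 1) * N" using \<open>card Z \<le> 1\<close> by linarith
      \<comment> \<open>The value \<open>0\<close>, not counted so far, leaves room for the zero vector.\<close>
      also have "\<dots> \<le> (t * w0) * N + (t * w0) * (CARD('a) - 1) * N"
      proof -
        have "1 \<le> t * w0 * N" unfolding N_def using assms(3) Suc.prems(2) by (simp add: Suc_le_eq)
        thus ?thesis by simp
      qed
      also have "\<dots> = (t * w0) * (1 + (CARD('a) - 1)) * N" by (simp only: ring_distribs mult.assoc mult_1 mult_1_right)
      also have "1 + (CARD('a) - 1) = CARD('a)" by (simp add: Suc_leI)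
      finally show False using Suc.prems(5) by (simp add: N_def)
    qed
    then obtain l a where la: "l \<in> U" "a \<noteq> 0" "N < card (F (l, a))" by auto
    define v' where "v' i = (v i)(l := v i l - a)" for i
    have "\<exists>\<chi> J. J \<subseteq> F (l, a) \<and> card J = t \<and>
      (\<forall>i\<in>J. \<forall>j\<in>J. i \<noteq> j \<longrightarrow> supp I (\<lambda>l. v' i l - \<chi> l) \<inter> supp I (\<lambda>l. v' j l - \<chi> l) = {})"
    proof (rule Suc.IH)
      show "finite (F (l, a))" using Suc.prems(1) by (simp add: F_def)
      show "w \<le> w0" using Suc.prems(2) by simp
      show "card (supp I (v' j)) \<le> w" if "j \<in> F (l, a)" for j
      proof -
        have "l \<in> I" using la(1) by (auto simp: U_def supp_def)
        hence "l \<in> supp I (v j)" using that la(2) by (simp add: F_def supp_def)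
        moreover have "supp I (v' j) = supp I (v j) - {l}"
          using that by (auto simp: F_def supp_def v'_def)
        ultimately show ?thesis using Suc.prems(3)[of j] that fsupp[of "v j"] by (auto simp: F_def)
      qed
      show "\<exists>l\<in>I. v' i l \<noteq> v' j l" if "i \<in> F (l, a)" "j \<in> F (l, a)" "i \<noteq> j" for i j
      proof -
        have "i \<in> K" "j \<in> K" using that by (simp_all add: F_def)
        then obtain m where m: "m \<in> I" "v i m \<noteq> v j m" using Suc.prems(4) \<open>i \<noteq> j\<close> by blast
        hence "m \<noteq> l" using that by (auto simp: F_def)
        thus ?thesis using m by (intro bexI[of _ m]) (auto simp: v'_def)
      qed
      show "(t * w0 * CARD('a)) ^ w < card (F (l, a))" using la(3) by (simp add: N_def)
    qed
    then obtain \<chi> J' where J': "J' \<subseteq> F (l, a)" "card J' = t"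
      "\<And>i j. i \<in> J' \<Longrightarrow> j \<in> J' \<Longrightarrow> i \<noteq> j \<Longrightarrow> supp I (\<lambda>l. v' i l - \<chi> l) \<inter> supp I (\<lambda>l. v' j l - \<chi> l) = {}"
      by blast
    have "(\<lambda>m. v' i m - \<chi> m) = (\<lambda>m. v i m - (\<chi>(l := \<chi> l + a)) m)" for i
      by (auto simp: v'_def algebra_simps)
    thus ?thesis using J' by (intro exI[of _ "\<chi>(l := \<chi> l + a)"] exI[of _ J']) (auto simp: F_def)
  qed
qed

section \<open>Spread families and families near a small span\<close>

text \<open>
  Greedy choice: keep adding a form at Hamming distance more than \<open>R\<close> from the span of those chosen so
  far. A combination that involves the new form is a nonzero multiple of the difference between
  the new form and an element of the span, so all nonzero combinations stay heavy. Either
  \<open>t\<close> forms get chosen, or at some stage every form is near the span.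
\<close>

lemma spread_or_concentrated:
  fixes M :: "nat \<Rightarrow> 'i \<Rightarrow> 'a::field"
  shows "(\<exists>J. J \<subseteq> K \<and> finite J \<and> card J = t \<and>
            (\<forall>u. (\<exists>j\<in>J. u j \<noteq> 0) \<longrightarrow> R < card (supp I (\<lambda>i. \<Sum>j\<in>J. u j * M j i)))) \<or>
         (\<exists>J. J \<subseteq> K \<and> finite J \<and> card J \<le> t \<and>
            (\<forall>k\<in>K. \<exists>u. card (supp I (\<lambda>i. M k i - (\<Sum>j\<in>J. u j * M j i))) \<le> R))"
proof (induction t)
  case 0
  show ?case by (rule disjI1, rule exI[of _ "{}"]) auto
next
  case (Suc t)
  from Suc.IH show ?case
  proof (elim disjE exE conjE)
    fix J assume J: "J \<subseteq> K" "finite J" "card J = t"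
      and spread: "\<forall>u. (\<exists>j\<in>J. u j \<noteq> 0) \<longrightarrow> R < card (supp I (\<lambda>i. \<Sum>j\<in>J. u j * M j i))"
    show ?thesis
    proof (cases "\<forall>k\<in>K. \<exists>u. card (supp I (\<lambda>i. M k i - (\<Sum>j\<in>J. u j * M j i))) \<le> R")
      case True
      thus ?thesis using J by (intro disjI2 exI[of _ J]) auto
    next
      case False
      then obtain k where k: "k \<in> K" "\<And>u. R < card (supp I (\<lambda>i. M k i - (\<Sum>j\<in>J. u j * M j i)))"
        by (auto simp: not_le)
      have kJ: "k \<notin> J"
      proof
        assume "k \<in> J"
        hence "(\<Sum>j\<in>J. (if j = k then 1 else 0) * M j i) = M k i" for i
          using J by (simp add: if_distrib[of "\<lambda>x. x * _"] cong: if_cong)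
        thus False using k(2)[of "\<lambda>j. if j = k then 1 else 0"] by (simp add: supp_def)
      qed
      have "R < card (supp I (\<lambda>i. \<Sum>j\<in>insert k J. u j * M j i))" if "\<exists>j\<in>insert k J. u j \<noteq> 0" for u
      proof (cases "u k = 0")
        case True
        hence "\<exists>j\<in>J. u j \<noteq> 0" using that by auto
        thus ?thesis using spread True J kJ by simp
      next
        case False
        have "(\<Sum>j\<in>insert k J. u j * M j i) = u k * (M k i - (\<Sum>j\<in>J. (- u j / u k) * M j i))" for i
          using J kJ False by (simp add: sum_negf sum_divide_distrib[symmetric] field_simps sum_distrib_left)
        hence "supp I (\<lambda>i. \<Sum>j\<in>insert k J. u j * M j i) = supp I (\<lambda>i. M k i - (\<Sum>j\<in>J. (- u j / u k) * M j i))"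
          using False by (auto simp: supp_def)
        thus ?thesis using k(2)[of "\<lambda>j. - u j / u k"] by simp
      qed
      thus ?thesis using J k(1) kJ by (intro disjI1 exI[of _ "insert k J"]) auto
    qed
  next
    fix J assume "J \<subseteq> K" "finite J" "card J \<le> t"
      "\<forall>k\<in>K. \<exists>u. card (supp I (\<lambda>i. M k i - (\<Sum>j\<in>J. u j * M j i))) \<le> R"
    thus ?thesis by (intro disjI2 exI[of _ J]) auto
  qed
qed

section \<open>Additive characters of the prime field\<close>

definition add_char :: "'p::prime_card mod_ring \<Rightarrow> complex" where
  "add_char x = cis (2 * pi * (real_of_int (to_int_mod_ring x) / real CARD('p)))"

lemma add_char_add: "add_char (x + y) = add_char x * add_char (y :: 'p::prime_card mod_ring)"
proof -
  let ?p = "int CARD('p)"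
  let ?a = "to_int_mod_ring x + to_int_mod_ring y"
  have "to_int_mod_ring (x + y) = ?a - ?p * (?a div ?p)"
    by (simp only: to_int_mod_ring_add minus_mult_div_eq_mod)
  hence "real_of_int (to_int_mod_ring (x + y)) = real_of_int (?a - ?p * (?a div ?p))"
    by (simp only:)
  also have "\<dots> = real_of_int (to_int_mod_ring x) + real_of_int (to_int_mod_ring y)
      - real CARD('p) * real_of_int (?a div ?p)"
    by (simp only: of_int_diff of_int_add of_int_mult of_int_of_nat_eq)
  finally have "real_of_int (to_int_mod_ring (x + y)) / real CARD('p)
      = real_of_int (to_int_mod_ring x) / real CARD('p) + real_of_int (to_int_mod_ring y) / real CARD('p)
        - real_of_int (?a div ?p)"
    by (simp only: diff_divide_distrib add_divide_distrib) simp
  hence "add_char (x + y) = cis (2 * pi * (real_of_int (to_int_mod_ring x) / real CARD('p))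
      + 2 * pi * (real_of_int (to_int_mod_ring y) / real CARD('p)) - 2 * pi * real_of_int (?a div ?p))"
    by (simp only: add_char_def ring_distribs)
  also have "\<dots> = add_char x * add_char y"
    unfolding add_char_def cis_divide[symmetric] cis_mult[symmetric] by simp
  finally show ?thesis .
qed

lemma norm_add_char [simp]: "norm (add_char x) = 1"
  by (simp add: add_char_def)

lemma add_char_0 [simp]: "add_char 0 = 1"
  by (simp add: add_char_def)

lemma add_char_eq_1_iff: "add_char (x :: 'p::prime_card mod_ring) = 1 \<longleftrightarrow> x = 0"
proof
  assume "add_char x = 1"
  then obtain n :: int where n: "2 * pi * (real_of_int (to_int_mod_ring x) / real CARD('p)) = of_int n * (2 * pi)"
    unfolding add_char_def cis_eq_1_iff by blast
  hence "2 * pi * (real_of_int (to_int_mod_ring x) / real CARD('p)) = 2 * pi * of_int n"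
    by (simp only: mult_ac)
  hence "real_of_int (to_int_mod_ring x) / real CARD('p) = of_int n"
    by (rule mult_left_cancel[THEN iffD1, rotated]) simp
  hence "real_of_int (to_int_mod_ring x) = real_of_int (n * int CARD('p))"
    by (simp add: divide_eq_eq)
  hence eq: "to_int_mod_ring x = n * int CARD('p)" by (simp only: of_int_eq_iff)
  have "to_int_mod_ring x \<in> {0..<int CARD('p)}"
    using range_to_int_mod_ring[where 'a='p] by blast
  hence "to_int_mod_ring x mod int CARD('p) = to_int_mod_ring x" by simp
  hence "to_int_mod_ring x = 0" using eq by simp
  thus "x = 0" by (metis of_int_mod_ring_to_int_mod_ring of_int_mod_ring_hom.hom_zero)
qed simp

lemma add_char_sum: "add_char (\<Sum>i\<in>A. f i) = (\<Prod>i\<in>A. add_char (f i))"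
  by (induction A rule: infinite_finite_induct) (auto simp: add_char_add)

lemma sum_add_char_mult:
  fixes z :: "'p::prime_card mod_ring"
  shows "(\<Sum>u\<in>UNIV. add_char (u * z)) = (if z = 0 then of_nat CARD('p) else 0)"
proof (cases "z = 0")
  case False
  let ?s = "\<Sum>u\<in>UNIV. add_char (u * z)"
  have "?s = (\<Sum>u\<in>UNIV. add_char ((u + 1) * z))"
    by (rule sum.reindex_bij_witness[of _ "\<lambda>u. u + 1" "\<lambda>u. u - 1"]) auto
  also have "\<dots> = ?s * add_char z"
    by (simp add: ring_distribs add_char_add sum_distrib_right)
  finally have "?s * (1 - add_char z) = 0" by (simp add: algebra_simps)
  thus ?thesis using False by (simp add: add_char_eq_1_iff)
qed simp

lemma sum_add_char_PiE:
  fixes z :: "'j \<Rightarrow> 'p::prime_card mod_ring"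
  assumes "finite J"
  shows "(\<Sum>u\<in>J \<rightarrow>\<^sub>E UNIV. add_char (\<Sum>j\<in>J. u j * z j))
    = (if \<forall>j\<in>J. z j = 0 then of_nat CARD('p) ^ card J else 0)"
proof -
  have "(\<Sum>u\<in>J \<rightarrow>\<^sub>E UNIV. add_char (\<Sum>j\<in>J. u j * z j)) = (\<Prod>j\<in>J. \<Sum>a\<in>UNIV. add_char (a * z j))"
    using assms by (simp add: add_char_sum prod_sum_PiE)
  also have "\<dots> = (if \<forall>j\<in>J. z j = 0 then of_nat CARD('p) ^ card J else 0)"
  proof (cases "\<forall>j\<in>J. z j = 0")
    case False
    hence "\<exists>j\<in>J. (\<Sum>a\<in>UNIV. add_char (a * z j)) = 0" by (auto simp: sum_add_char_mult)
    thus ?thesis using assms False by (simp only: prod_zero if_False)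
  qed simp
  finally show ?thesis .
qed

lemma norm_add_unit_less:
  fixes z w :: complex
  assumes "norm z = 1" "norm w = 1" "z \<noteq> w"
  shows "norm (z + w) < 2"
proof -
  have "(norm (z + w))\<^sup>2 + (norm (z - w))\<^sup>2 = 2 * (norm z)\<^sup>2 + 2 * (norm w)\<^sup>2"
    unfolding cmod_power2 by (simp add: power2_eq_square algebra_simps)
  moreover have "(norm (z - w))\<^sup>2 > 0" using assms by simp
  ultimately have "(norm (z + w))\<^sup>2 < 2 * (norm z)\<^sup>2 + 2 * (norm w)\<^sup>2" by linarith
  hence "(norm (z + w))\<^sup>2 < 2\<^sup>2" using assms by simp
  thus ?thesis by (rule power2_less_imp_less) simp
qed

text \<open>
  Since \<open>S\<close> contains two distinct elements, the unit vectors in the sum are not all equal, so the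
  triangle inequality is strict; as the field is finite, this gains a uniform factor.
\<close>

lemma add_char_sum_bias:
  fixes S :: "'p::prime_card mod_ring set"
  assumes "card S \<ge> 2"
  shows "\<exists>\<rho>. 0 < \<rho> \<and> \<rho> < 1 \<and> (\<forall>a. a \<noteq> 0 \<longrightarrow> norm (\<Sum>s\<in>S. add_char (a * s)) \<le> \<rho> * real (card S))"
proof -
  have less: "norm (\<Sum>s\<in>S. add_char (a * s)) < real (card S)" if "a \<noteq> 0" for a
  proof -
    obtain s t where st: "s \<in> S" "t \<in> S" "s \<noteq> t"
      using assms by (metis card_le_Suc0_iff_eq finite not_less_eq_eq numeral_2_eq_2)
    have ne: "add_char (a * s) \<noteq> add_char (a * t)"
    proof
      assume eq: "add_char (a * s) = add_char (a * t)"
      have "add_char (a * s) = add_char (a * t) * add_char (a * (s - t))"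
        unfolding add_char_add[symmetric] by (simp add: right_diff_distrib)
      hence "add_char (a * (s - t)) = 1"
        using eq norm_add_char[of "a * t"] by (metis mult_cancel_left1 norm_zero zero_neq_one)
      thus False using st that by (simp add: add_char_eq_1_iff)
    qed
    have S: "S = insert s (insert t (S - {s, t}))" using st by auto
    have "(\<Sum>s\<in>S. add_char (a * s)) = (add_char (a * s) + add_char (a * t)) + (\<Sum>x\<in>S - {s,t}. add_char (a * x))"
      by (subst S) (use st in \<open>simp add: add.assoc\<close>)
    also have "norm \<dots> \<le> norm (add_char (a * s) + add_char (a * t)) + norm (\<Sum>x\<in>S - {s,t}. add_char (a * x))"
      by (rule norm_triangle_ineq)
    also have "\<dots> < 2 + real (card (S - {s, t}))"
    proof (rule add_less_le_mono)
      show "norm (add_char (a * s) + add_char (a * t)) < 2" by (rule norm_add_unit_less) (use ne in auto)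
      show "norm (\<Sum>x\<in>S - {s,t}. add_char (a * x)) \<le> real (card (S - {s, t}))"
        by (rule order_trans[OF norm_sum]) simp
    qed
    also have "\<dots> = real (card S)" using st assms by (simp add: card_Diff_subset)
    finally show ?thesis .
  qed
  define \<rho> where "\<rho> = Max (insert (1/2) ((\<lambda>a. norm (\<Sum>s\<in>S. add_char (a * s)) / real (card S)) ` (UNIV - {0})))"
  have "1/2 \<le> \<rho>" unfolding \<rho>_def by (intro Max_ge) auto
  moreover have "\<rho> < 1"
    unfolding \<rho>_def using less assms by (subst Max_less_iff) (auto simp: divide_less_eq)
  moreover have "norm (\<Sum>s\<in>S. add_char (a * s)) \<le> \<rho> * real (card S)" if "a \<noteq> 0" for a
  proof -
    have "norm (\<Sum>s\<in>S. add_char (a * s)) / real (card S) \<le> \<rho>"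
      unfolding \<rho>_def using that by (intro Max_ge) auto
    thus ?thesis using assms by (simp add: divide_le_eq)
  qed
  ultimately show ?thesis by (intro exI[of _ \<rho>]) auto
qed

section \<open>Equidistribution of spread families\<close>

text \<open>
  The Fourier expansion of the indicator function of the system of equations has one term for
  each combination \<open>u\<close> of the forms. The zero combination gives the main term. For any other \<open>u\<close>
  the average of the character factorises over the coordinates, and each of the at least \<open>R\<close>
  coordinates on which the combination is nonzero contributes a factor at most \<open>\<rho>\<close>.
\<close>

lemma card_fibre_spread:
  fixes S :: "'p::prime_card mod_ring set" and M :: "'j \<Rightarrow> 'i \<Rightarrow> 'p mod_ring"
  assumes "finite I" "finite J" "0 \<le> \<rho>" "\<rho> \<le> 1"
    and bias: "\<And>a. a \<noteq> 0 \<Longrightarrow> norm (\<Sum>s\<in>S. add_char (a * s)) \<le> \<rho> * real (card S)"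
    and spread: "\<And>u. \<exists>j\<in>J. u j \<noteq> 0 \<Longrightarrow> R \<le> card (supp I (\<lambda>i. \<Sum>j\<in>J. u j * M j i))"
  shows "real CARD('p) ^ card J * real (card {x \<in> I \<rightarrow>\<^sub>E S. \<forall>j\<in>J. form I (M j) x = y j})
    \<le> real (card S) ^ card I * (1 + real CARD('p) ^ card J * \<rho> ^ R)"
proof -
  let ?X = "I \<rightarrow>\<^sub>E S" and ?U = "J \<rightarrow>\<^sub>E (UNIV :: 'p mod_ring set)"
  let ?N = "{x \<in> ?X. \<forall>j\<in>J. form I (M j) x = y j}"
  let ?c = "\<lambda>u i. \<Sum>j\<in>J. u j * M j i"
  let ?p = "real CARD('p)" and ?s = "real (card S)"
  have finX: "finite ?X" and finU: "finite ?U" using assms(1,2) by (auto intro: finite_PiE)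
  have "of_real (?p ^ card J * real (card ?N)) = (\<Sum>x\<in>?N. of_nat CARD('p) ^ card J :: complex)"
    by simp
  also have "\<dots> = (\<Sum>x\<in>?X. if \<forall>j\<in>J. form I (M j) x - y j = 0 then of_nat CARD('p) ^ card J else 0)"
    using finX by (subst sum.inter_filter) (simp_all only: right_minus_eq)
  also have "\<dots> = (\<Sum>x\<in>?X. \<Sum>u\<in>?U. add_char (\<Sum>j\<in>J. u j * (form I (M j) x - y j)))"
    by (simp only: sum_add_char_PiE[OF assms(2)])
  also have "\<dots> = (\<Sum>u\<in>?U. \<Sum>x\<in>?X. add_char (\<Sum>j\<in>J. u j * (form I (M j) x - y j)))"
    by (rule sum.swap)
  also have "\<dots> = (\<Sum>u\<in>?U. add_char (- (\<Sum>j\<in>J. u j * y j)) * (\<Prod>i\<in>I. \<Sum>s\<in>S. add_char (?c u i * s)))"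
  proof (rule sum.cong[OF refl])
    fix u
    have "(\<Sum>j\<in>J. u j * (form I (M j) x - y j)) = - (\<Sum>j\<in>J. u j * y j) + (\<Sum>i\<in>I. ?c u i * x i)" for x
    proof -
      have "(\<Sum>j\<in>J. u j * form I (M j) x) = (\<Sum>j\<in>J. \<Sum>i\<in>I. u j * M j i * x i)"
        by (simp add: form_def sum_distrib_left mult.assoc)
      also have "\<dots> = (\<Sum>i\<in>I. \<Sum>j\<in>J. u j * M j i * x i)" by (rule sum.swap)
      finally have "(\<Sum>j\<in>J. u j * form I (M j) x) = (\<Sum>i\<in>I. ?c u i * x i)"
        by (simp only: sum_distrib_right)
      thus ?thesis by (simp add: right_diff_distrib sum_subtractf)
    qed
    hence "(\<Sum>x\<in>?X. add_char (\<Sum>j\<in>J. u j * (form I (M j) x - y j)))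
        = (\<Sum>x\<in>?X. add_char (- (\<Sum>j\<in>J. u j * y j)) * (\<Prod>i\<in>I. add_char (?c u i * x i)))"
      by (simp only: add_char_add add_char_sum)
    also have "\<dots> = add_char (- (\<Sum>j\<in>J. u j * y j)) * (\<Sum>x\<in>?X. \<Prod>i\<in>I. add_char (?c u i * x i))"
      by (simp only: sum_distrib_left)
    also have "(\<Sum>x\<in>?X. \<Prod>i\<in>I. add_char (?c u i * x i)) = (\<Prod>i\<in>I. \<Sum>s\<in>S. add_char (?c u i * s))"
      using assms(1) by (subst prod_sum_PiE) simp_all
    finally show "(\<Sum>x\<in>?X. add_char (\<Sum>j\<in>J. u j * (form I (M j) x - y j)))
        = add_char (- (\<Sum>j\<in>J. u j * y j)) * (\<Prod>i\<in>I. \<Sum>s\<in>S. add_char (?c u i * s))"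
      .
  qed
  finally have "of_real (?p ^ card J * real (card ?N)) =
    (\<Sum>u\<in>?U. add_char (- (\<Sum>j\<in>J. u j * y j)) * (\<Prod>i\<in>I. \<Sum>s\<in>S. add_char (?c u i * s)))" (is "?L = ?Rs") .
  hence "norm ?L = norm ?Rs" by (rule arg_cong)
  hence "?p ^ card J * real (card ?N) = norm ?Rs" by (simp only: norm_of_real) simp
  also have "\<dots> \<le> (\<Sum>u\<in>?U. norm (\<Prod>i\<in>I. \<Sum>s\<in>S. add_char (?c u i * s)))"
    by (rule order_trans[OF norm_sum]) (simp only: norm_mult norm_add_char mult_1 order_refl)
  also have "\<dots> \<le> (\<Sum>u\<in>?U. (if \<forall>j\<in>J. u j = 0 then ?s ^ card I else 0) + ?s ^ card I * \<rho> ^ R)"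
  proof (rule sum_mono)
    fix u assume "u \<in> ?U"
    have norm1: "norm (\<Sum>s\<in>S. add_char (?c u i * s)) \<le> (if ?c u i = 0 then 1 else \<rho>) * ?s" for i
      using bias[of "?c u i"] by auto
    have "norm (\<Prod>i\<in>I. \<Sum>s\<in>S. add_char (?c u i * s)) \<le> (\<Prod>i\<in>I. (if ?c u i = 0 then 1 else \<rho>) * ?s)"
      unfolding prod_norm[symmetric] by (rule prod_mono) (use norm1 in auto)
    also have "\<dots> = \<rho> ^ card (supp I (?c u)) * ?s ^ card I"
    proof -
      have "(\<Prod>i\<in>I. if ?c u i = 0 then 1 else \<rho>) = (\<Prod>i\<in>supp I (?c u). \<rho>)"
        unfolding supp_def using assms(1) by (subst prod.inter_filter) (auto intro!: prod.cong)
      thus ?thesis by (simp only: prod.distrib prod_constant)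
    qed
    also have "\<dots> \<le> (if \<forall>j\<in>J. u j = 0 then ?s ^ card I else 0) + ?s ^ card I * \<rho> ^ R"
    proof (cases "\<forall>j\<in>J. u j = 0")
      case True
      hence "supp I (?c u) = {}" by (simp add: supp_def)
      thus ?thesis using True assms(3) by simp
    next
      case False
      hence "\<rho> ^ card (supp I (?c u)) \<le> \<rho> ^ R"
        using spread[of u] assms(3,4) by (intro power_decreasing) auto
      hence "?s ^ card I * \<rho> ^ card (supp I (?c u)) \<le> ?s ^ card I * \<rho> ^ R"
        by (rule mult_left_mono) simp
      thus ?thesis using False by (simp only: if_False add_0 mult.commute)
    qed
    finally show "norm (\<Prod>i\<in>I. \<Sum>s\<in>S. add_char (?c u i * s))
      \<le> (if \<forall>j\<in>J. u j = 0 then ?s ^ card I else 0) + ?s ^ card I * \<rho> ^ R" .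
  qed
  also have "\<dots> = real (card {u \<in> ?U. \<forall>j\<in>J. u j = 0}) * ?s ^ card I + ?p ^ card J * (?s ^ card I * \<rho> ^ R)"
  proof -
    have "(\<Sum>u\<in>?U. if \<forall>j\<in>J. u j = 0 then ?s ^ card I else 0)
        = (\<Sum>u\<in>{u \<in> ?U. \<forall>j\<in>J. u j = 0}. ?s ^ card I)"
      using finU by (rule sum.inter_filter[symmetric])
    thus ?thesis using assms(2) by (simp only: sum.distrib sum_constant card_funcsetE) simp
  qed
  also have "{u \<in> ?U. \<forall>j\<in>J. u j = 0} = J \<rightarrow>\<^sub>E {0}"
    by (rule Set.set_eqI) (simp only: PiE_iff mem_Collect_eq UNIV_I singleton_iff, blast)
  also have "card (J \<rightarrow>\<^sub>E {0 :: 'p mod_ring}) = 1" using assms(2) by (simp add: card_funcsetE)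
  finally show ?thesis by (simp add: distrib_left mult_ac)
qed

text \<open>
  Summing over the at most \<open>r ^ card J\<close> admissible tuples of values.
\<close>

lemma card_spread_system:
  fixes S :: "'p::prime_card mod_ring set" and M :: "'j \<Rightarrow> 'i \<Rightarrow> 'p mod_ring"
  assumes "finite I" "finite J" "0 \<le> \<rho>" "\<rho> \<le> 1"
    and bias: "\<And>a. a \<noteq> 0 \<Longrightarrow> norm (\<Sum>s\<in>S. add_char (a * s)) \<le> \<rho> * real (card S)"
    and spread: "\<And>u. \<exists>j\<in>J. u j \<noteq> 0 \<Longrightarrow> R \<le> card (supp I (\<lambda>i. \<Sum>j\<in>J. u j * M j i))"
    and E: "\<And>j. j \<in> J \<Longrightarrow> card (E j) \<le> r"
  shows "real (card {x \<in> I \<rightarrow>\<^sub>E S. \<forall>j\<in>J. form I (M j) x \<in> E j})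
    \<le> real (card S) ^ card I * (1 + real CARD('p) ^ card J * \<rho> ^ R) * (real r / real CARD('p)) ^ card J"
proof -
  let ?Y = "PiE J E" and ?p = "real CARD('p)"
  define N where "N y = {x \<in> I \<rightarrow>\<^sub>E S. \<forall>j\<in>J. form I (M j) x = y j}" for y
  define B where "B = real (card S) ^ card I * (1 + ?p ^ card J * \<rho> ^ R)"
  have B0: "0 \<le> B" unfolding B_def using assms(3) by simp
  have finY: "finite ?Y" using assms(2) by (auto intro: finite_PiE)
  have finX: "finite (I \<rightarrow>\<^sub>E S)" using assms(1) by (auto intro: finite_PiE)
  have "{x \<in> I \<rightarrow>\<^sub>E S. \<forall>j\<in>J. form I (M j) x \<in> E j} \<subseteq> (\<Union>y\<in>?Y. N y)"
  proof
    fix x assume "x \<in> {x \<in> I \<rightarrow>\<^sub>E S. \<forall>j\<in>J. form I (M j) x \<in> E j}"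
    thus "x \<in> (\<Union>y\<in>?Y. N y)"
      by (intro UN_I[of "\<lambda>j\<in>J. form I (M j) x"]) (auto simp: N_def)
  qed
  hence "card {x \<in> I \<rightarrow>\<^sub>E S. \<forall>j\<in>J. form I (M j) x \<in> E j} \<le> card (\<Union>y\<in>?Y. N y)"
    using finY finX by (intro card_mono) (auto simp: N_def)
  also have "\<dots> \<le> (\<Sum>y\<in>?Y. card (N y))" by (rule card_UN_le[OF finY])
  finally have "real (card {x \<in> I \<rightarrow>\<^sub>E S. \<forall>j\<in>J. form I (M j) x \<in> E j}) \<le> real (\<Sum>y\<in>?Y. card (N y))"
    by (simp only: of_nat_le_iff)
  also have "\<dots> \<le> (\<Sum>y\<in>?Y. B / ?p ^ card J)"
  proof (subst of_nat_sum, rule sum_mono)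
    fix y
    have "?p ^ card J * real (card (N y)) \<le> B"
      unfolding N_def B_def by (rule card_fibre_spread) (use assms in auto)
    thus "real (card (N y)) \<le> B / ?p ^ card J" by (simp add: field_simps)
  qed
  also have "\<dots> = real (card ?Y) * (B / ?p ^ card J)" by simp
  also have "\<dots> \<le> real r ^ card J * (B / ?p ^ card J)"
  proof (rule mult_right_mono)
    have "card ?Y = (\<Prod>j\<in>J. card (E j))" using assms(2) by (simp add: card_PiE)
    also have "\<dots> \<le> (\<Prod>j\<in>J. r)" by (rule prod_mono) (use E in auto)
    finally show "real (card ?Y) \<le> real r ^ card J" by (simp flip: of_nat_power)
  qed (use B0 in auto)
  also have "\<dots> = B * (real r / ?p) ^ card J" by (simp add: power_divide)
  finally show ?thesis unfolding B_def .
qed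

section \<open>Families near a small span\<close>

text \<open>
  There are at most \<open>p ^ T\<close> elements in the span of the forms \<open>B j\<close>, so many of the forms
  are near the same element \<open>b\<close> of it. The sunflower lemma, applied to their differences with \<open>b\<close>,
  yields \<open>T + 1\<close> forms which after subtraction of a common form \<open>b + \<chi>\<close> have disjoint supports.
  Two of these supports cannot both have size at most \<open>d\<close>, because the difference of two forms
  has support at least \<open>2 d + 1\<close>; this explains the hypothesis \<open>sep\<close>, and leaves \<open>T\<close> forms whose
  supports contain disjoint blocks of size \<open>d + 1\<close>. For each of the \<open>p\<close> possible values \<open>v\<close> of
  the common form, the conditions become conditions on these sparse parts, with shifted target sets.
\<close>

lemma card_concentrated_system:
  fixes S :: "'p::prime_card mod_ring set" and M :: "'k \<Rightarrow> 'i \<Rightarrow> 'p mod_ring"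
  assumes "finite I" "finite K" "finite J" "card J \<le> T" "S \<noteq> {}"
    and "r < CARD('p)" "r \<le> (d + 1) * (card S - 1)"
    and E: "\<And>k. k \<in> K \<Longrightarrow> card (E k) \<le> r"
    and near: "\<And>k. k \<in> K \<Longrightarrow> \<exists>u. card (supp I (\<lambda>i. M k i - (\<Sum>j\<in>J. u j * B j i))) \<le> R"
    and sep: "\<And>j k. j \<in> K \<Longrightarrow> k \<in> K \<Longrightarrow> j \<noteq> k \<Longrightarrow> 2 * d + 1 \<le> card (supp I (\<lambda>i. M k i - M j i))"
    and large: "CARD('p) ^ T * ((T + 1) * R * CARD('p)) ^ R < card K"
  shows "card {x \<in> I \<rightarrow>\<^sub>E S. \<forall>k\<in>K. form I (M k) x \<in> E k} * card S ^ ((d + 1) * T)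
    \<le> CARD('p) * ((card S ^ (d + 1) - 1) ^ T * card S ^ card I)"
proof -
  have fsupp: "finite (supp I c)" for c :: "'i \<Rightarrow> 'p mod_ring" using assms(1) by (simp add: supp_def)
  have finX: "finite (I \<rightarrow>\<^sub>E S)" using assms(1) by (auto intro: finite_PiE)
  define N where "N = ((T + 1) * R * CARD('p)) ^ R"
  obtain u where u: "\<And>k. k \<in> K \<Longrightarrow> card (supp I (\<lambda>i. M k i - (\<Sum>j\<in>J. u k j * B j i))) \<le> R"
    using bchoice[of K "\<lambda>k u. card (supp I (\<lambda>i. M k i - (\<Sum>j\<in>J. u j * B j i))) \<le> R"] near by blast
  define f where "f k = restrict (u k) J" for k
  have fin: "finite (J \<rightarrow>\<^sub>E (UNIV :: 'p mod_ring set))" using assms(3) by (auto intro: finite_PiE)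
  have "\<exists>g\<in>J \<rightarrow>\<^sub>E UNIV. N < card {k \<in> K. f k = g}"
  proof (rule ccontr)
    assume "\<not> ?thesis"
    hence "card K \<le> card (J \<rightarrow>\<^sub>E (UNIV :: 'p mod_ring set)) * N"
      using fin assms(2) by (intro card_le_fibres[where f = f]) (auto simp: f_def not_less)
    also have "card (J \<rightarrow>\<^sub>E (UNIV :: 'p mod_ring set)) = CARD('p) ^ card J"
      using assms(3) by (simp add: card_funcsetE)
    also have "\<dots> \<le> CARD('p) ^ T" using assms(4) by (intro power_increasing) (auto simp: Suc_leI)
    finally show False using large by (simp add: N_def)
  qed
  then obtain g where g: "N < card {k \<in> K. f k = g}" by auto
  define K0 where "K0 = {k \<in> K. f k = g}"
  define b where "b i = (\<Sum>j\<in>J. g j * B j i)" for i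
  have K0K: "K0 \<subseteq> K" by (auto simp: K0_def)
  have light: "card (supp I (\<lambda>i. M k i - b i)) \<le> R" if "k \<in> K0" for k
  proof -
    have "b i = (\<Sum>j\<in>J. u k j * B j i)" for i
      unfolding b_def using that by (intro sum.cong) (auto simp: K0_def f_def)
    thus ?thesis using u[of k] that K0K by auto
  qed
  have "\<exists>\<chi> J'. J' \<subseteq> K0 \<and> card J' = T + 1 \<and>
    (\<forall>i\<in>J'. \<forall>j\<in>J'. i \<noteq> j \<longrightarrow> supp I (\<lambda>l. (M i l - b l) - \<chi> l) \<inter> supp I (\<lambda>l. (M j l - b l) - \<chi> l) = {})"
  proof (rule vector_sunflower[where w = R and w0 = R])
    show "finite K0" using assms(2) K0K finite_subset by auto
    show "\<exists>l\<in>I. M i l - b l \<noteq> M j l - b l" if "i \<in> K0" "j \<in> K0" "i \<noteq> j" for i j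
    proof (rule ccontr)
      assume "\<not> ?thesis"
      hence "supp I (\<lambda>l. M j l - M i l) = {}" by (auto simp: supp_def)
      thus False using sep[of i j] that K0K by auto
    qed
    show "((T + 1) * R * CARD('p mod_ring)) ^ R < card K0" using g by (simp add: K0_def N_def)
  qed (use light assms(1) in auto)
  then obtain \<chi> J' where J': "J' \<subseteq> K0" "card J' = T + 1"
    and disj: "\<And>i j. i \<in> J' \<Longrightarrow> j \<in> J' \<Longrightarrow> i \<noteq> j \<Longrightarrow>
      supp I (\<lambda>l. (M i l - b l) - \<chi> l) \<inter> supp I (\<lambda>l. (M j l - b l) - \<chi> l) = {}"
    by blast
  define \<eta> where "\<eta> k l = (M k l - b l) - \<chi> l" for k l
  define J0 where "J0 = {k \<in> J'. card (supp I (\<eta> k)) \<le> d}"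
  have fJ': "finite J'" using J' by (metis card.infinite add_is_0 one_neq_zero)
  have "card J0 \<le> 1"
  proof -
    have "i = j" if "i \<in> J0" "j \<in> J0" for i j
    proof (rule ccontr)
      assume "i \<noteq> j"
      have "supp I (\<lambda>l. M j l - M i l) \<subseteq> supp I (\<eta> i) \<union> supp I (\<eta> j)"
        by (auto simp: supp_def \<eta>_def) (metis diff_add_cancel)
      hence "card (supp I (\<lambda>l. M j l - M i l)) \<le> card (supp I (\<eta> i) \<union> supp I (\<eta> j))"
        using fsupp by (intro card_mono) auto
      also have "\<dots> \<le> card (supp I (\<eta> i)) + card (supp I (\<eta> j))" by (rule card_Un_le)
      also have "\<dots> \<le> 2 * d" using that by (auto simp: J0_def)
      finally show False using sep[of i j] that \<open>i \<noteq> j\<close> J' K0K by (auto simp: J0_def)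
    qed
    moreover have "finite J0" using fJ' by (simp add: J0_def)
    ultimately show ?thesis using card_le_Suc0_iff_eq[of J0] by auto
  qed
  hence "T \<le> card (J' - J0)"
    using J'(2) fJ' by (subst card_Diff_subset) (auto simp: J0_def)
  then obtain J1 where J1: "J1 \<subseteq> J' - J0" "card J1 = T" "finite J1"
    using obtain_subset_with_card_n by metis
  have J1K: "J1 \<subseteq> K" using J1 J' K0K by auto
  have "\<exists>W. W \<subseteq> supp I (\<eta> k) \<and> card W = d + 1 \<and> finite W" if "k \<in> J1" for k
  proof -
    have "d + 1 \<le> card (supp I (\<eta> k))" using that J1 by (auto simp: J0_def)
    thus ?thesis using obtain_subset_with_card_n by metis
  qed
  then obtain W where W: "\<And>k. k \<in> J1 \<Longrightarrow> W k \<subseteq> supp I (\<eta> k)" "\<And>k. k \<in> J1 \<Longrightarrow> card (W k) = d + 1"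
    "\<And>k. k \<in> J1 \<Longrightarrow> finite (W k)" by metis
  define X where "X v = {x \<in> I \<rightarrow>\<^sub>E S. \<forall>k\<in>J1. form I (\<eta> k) x \<in> (\<lambda>e. e - v) ` E k}" for v
  have X: "card (X v) * card S ^ ((d + 1) * T) \<le> (card S ^ (d + 1) - 1) ^ T * card S ^ card I" for v
    unfolding X_def J1(2)[symmetric]
  proof (rule card_avoiding_disjoint_blocks)
    show "W k \<subseteq> I" if "k \<in> J1" for k using W(1)[OF that] by (auto simp: supp_def)
    show "l \<notin> W j \<and> \<eta> j l = 0" if "i \<in> J1" "j \<in> J1" "i \<noteq> j" "l \<in> W i" for i j l
    proof -
      have "supp I (\<eta> i) \<inter> supp I (\<eta> j) = {}"
        unfolding \<eta>_def using disj[of i j] that J1 by auto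
      moreover have "l \<in> supp I (\<eta> i)" using W(1)[of i] that by auto
      ultimately have "l \<notin> supp I (\<eta> j)" "l \<in> I" by (auto simp: supp_def)
      thus ?thesis using W(1)[of j] that by (auto simp: supp_def)
    qed
    show "\<exists>x\<in>W k \<rightarrow>\<^sub>E S. form (W k) (\<eta> k) x + y \<notin> (\<lambda>e. e - v) ` E k" if "k \<in> J1" for k y
    proof (rule form_avoids_small_set)
      have "card ((\<lambda>e. e - v) ` E k) \<le> r"
        using card_image_le[of "E k" "\<lambda>e. e - v"] E[of k] that J1K by fastforce
      thus "card ((\<lambda>e. e - v) ` E k) < CARD('p)" "card ((\<lambda>e. e - v) ` E k) \<le> card (W k) * (card S - 1)"
        using assms(6,7) W(2)[OF that] by auto
    qed (use W that assms(5) in \<open>auto simp: supp_def\<close>)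
  qed (use W J1 assms(1) in auto)
  have "{x \<in> I \<rightarrow>\<^sub>E S. \<forall>k\<in>K. form I (M k) x \<in> E k} \<subseteq> (\<Union>v. X v)"
  proof
    fix x assume x: "x \<in> {x \<in> I \<rightarrow>\<^sub>E S. \<forall>k\<in>K. form I (M k) x \<in> E k}"
    have "form I (\<eta> k) x = form I (M k) x - form I (\<lambda>l. b l + \<chi> l) x" for k
      by (simp add: form_def \<eta>_def algebra_simps sum_subtractf sum.distrib)
    hence "x \<in> X (form I (\<lambda>l. b l + \<chi> l) x)" using x J1K by (auto simp: X_def)
    thus "x \<in> (\<Union>v. X v)" by auto
  qed
  hence "card {x \<in> I \<rightarrow>\<^sub>E S. \<forall>k\<in>K. form I (M k) x \<in> E k} \<le> card (\<Union>v. X v)"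
    using finX by (intro card_mono) (auto simp: X_def)
  also have "\<dots> \<le> (\<Sum>v\<in>UNIV. card (X v))" by (rule card_UN_le) simp
  finally have "card {x \<in> I \<rightarrow>\<^sub>E S. \<forall>k\<in>K. form I (M k) x \<in> E k} * card S ^ ((d + 1) * T)
    \<le> (\<Sum>v\<in>UNIV. card (X v)) * card S ^ ((d + 1) * T)"
    by (rule mult_right_mono) simp
  also have "\<dots> \<le> (\<Sum>v\<in>(UNIV :: 'p mod_ring set). (card S ^ (d + 1) - 1) ^ T * card S ^ card I)"
    unfolding sum_distrib_right by (rule sum_mono) (rule X)
  finally show ?thesis by simp
qed

section \<open>The density bound\<close>

text \<open>
  Here \<open>q\<close> is the worse of the two decay rates: \<open>1 - 1 / p\<close> for a spread family, as \<open>r / p\<close> is at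
  most this, and \<open>1 - 1 / s ^ (d + 1)\<close>, with \<open>s\<close> the size of \<open>S\<close>, for forms escaping on disjoint
  blocks of size \<open>d + 1\<close>. The constant \<open>C\<close> is chosen with \<open>\<rho> ^ C < 1 / p\<close>, so that weights above
  \<open>C T\<close> make the error term of the Fourier estimate for \<open>T\<close> forms at most its main term. In the
  lower bound on \<open>card K\<close>, the factor \<open>p ^ T\<close> pays for the choice of an element of the span, and the
  other factor is the threshold of the sunflower lemma.
\<close>

lemma density_bound:
  fixes S :: "'p::prime_card mod_ring set"
  assumes "2 \<le> card S" "1 \<le> r" "r < CARD('p)"
  defines "d \<equiv> (r - 1) div (card S - 1)"
  shows "\<exists>q C. 0 < q \<and> q < 1 \<and>
    (\<forall>T (I :: 'i set) K (M :: nat \<Rightarrow> 'i \<Rightarrow> 'p mod_ring) E.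
      finite I \<longrightarrow> finite K \<longrightarrow> (\<forall>k\<in>K. card (E k) \<le> r) \<longrightarrow>
      (\<forall>j\<in>K. \<forall>k\<in>K. j \<noteq> k \<longrightarrow> 2 * d + 1 \<le> card (supp I (\<lambda>i. M k i - M j i))) \<longrightarrow>
      CARD('p) ^ T * ((T + 1) * (C * T) * CARD('p)) ^ (C * T) < card K \<longrightarrow>
      real (card {x \<in> I \<rightarrow>\<^sub>E S. \<forall>k\<in>K. form I (M k) x \<in> E k})
        \<le> real CARD('p) * q ^ T * real (card S) ^ card I)"
proof -
  let ?p = "real CARD('p)" and ?s = "real (card S)"
  have p: "2 \<le> ?p" using assms(2,3) by linarith
  obtain \<rho> where \<rho>: "0 < \<rho>" "\<rho> < 1"
    and bias: "\<And>a. a \<noteq> 0 \<Longrightarrow> norm (\<Sum>s\<in>S. add_char (a * s)) \<le> \<rho> * ?s"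
    using add_char_sum_bias[OF assms(1)] by blast
  obtain C where C: "\<rho> ^ C < 1 / ?p"
    using real_arch_pow_inv[of "1 / ?p" \<rho>] \<rho> by auto
  define q where "q = max (1 - 1 / ?p) (1 - 1 / ?s ^ (d + 1))"
  have spos: "?s > 0" using assms(1) by simp
  have q: "0 < q" "q < 1" using p spos by (auto simp: q_def less_max_iff_disj)
  have "real (card {x \<in> I \<rightarrow>\<^sub>E S. \<forall>k\<in>K. form I (M k) x \<in> E k}) \<le> ?p * q ^ T * ?s ^ card I"
    if fin: "finite I" "finite K" and E: "\<forall>k\<in>K. card (E k) \<le> r"
      and sep: "\<forall>j\<in>K. \<forall>k\<in>K. j \<noteq> k \<longrightarrow> 2 * d + 1 \<le> card (supp I (\<lambda>i. M k i - M j i))"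
      and large: "CARD('p) ^ T * ((T + 1) * (C * T) * CARD('p)) ^ (C * T) < card K"
    for T K E and I :: "'i set" and M :: "nat \<Rightarrow> 'i \<Rightarrow> 'p mod_ring"
  proof -
    let ?X = "{x \<in> I \<rightarrow>\<^sub>E S. \<forall>k\<in>K. form I (M k) x \<in> E k}"
    from spread_or_concentrated[of K T "C * T" I M] show ?thesis
    proof (elim disjE exE conjE)
      fix J assume J: "J \<subseteq> K" "finite J" "card J = T"
        and spread: "\<forall>u. (\<exists>j\<in>J. u j \<noteq> 0) \<longrightarrow> C * T < card (supp I (\<lambda>i. \<Sum>j\<in>J. u j * M j i))"
      have "finite (I \<rightarrow>\<^sub>E S)" using fin by (auto intro: finite_PiE)
      hence "real (card ?X) \<le> real (card {x \<in> I \<rightarrow>\<^sub>E S. \<forall>k\<in>J. form I (M k) x \<in> E k})"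
        unfolding of_nat_le_iff using J by (intro card_mono) auto
      also have "\<dots> \<le> ?s ^ card I * (1 + ?p ^ card J * \<rho> ^ (C * T)) * (real r / ?p) ^ card J"
        by (rule card_spread_system) (use J fin \<rho> bias spread E in \<open>auto intro: less_imp_le\<close>)
      also have "\<dots> \<le> ?s ^ card I * ?p * q ^ T"
      proof (intro mult_mono mult_left_mono)
        have "?p ^ T * \<rho> ^ (C * T) = (?p * \<rho> ^ C) ^ T" by (simp add: power_mult power_mult_distrib)
        also have "\<dots> \<le> 1" using C p \<rho> by (intro power_le_one) (auto simp: field_simps)
        finally show "1 + ?p ^ card J * \<rho> ^ (C * T) \<le> ?p" using p J(3) by simp
        have "real r / ?p \<le> 1 - 1 / ?p" using assms(3) p by (simp add: field_simps)
        also have "\<dots> \<le> q" by (simp add: q_def)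
        finally show "(real r / ?p) ^ card J \<le> q ^ T" using J(3) by (simp add: power_mono)
      qed (use \<rho> in auto)
      finally show ?thesis by (simp add: mult_ac)
    next
      fix J assume J: "J \<subseteq> K" "finite J" "card J \<le> T"
        and near: "\<forall>k\<in>K. \<exists>u. card (supp I (\<lambda>i. M k i - (\<Sum>j\<in>J. u j * M j i))) \<le> C * T"
      have "r - 1 < (d + 1) * (card S - 1)"
        unfolding d_def using dividend_less_div_times[of "card S - 1" "r - 1"] assms(1)
        by (simp add: algebra_simps)
      hence "r \<le> (d + 1) * (card S - 1)" by linarith
      hence "card ?X * card S ^ ((d + 1) * T)
          \<le> CARD('p) * ((card S ^ (d + 1) - 1) ^ T * card S ^ card I)"
        using J near sep E large fin assms(1,3)
        by (intro card_concentrated_system[where J = J and B = M and R = "C * T" and r = r]) auto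
      hence "real (card ?X * card S ^ ((d + 1) * T))
          \<le> real (CARD('p) * ((card S ^ (d + 1) - 1) ^ T * card S ^ card I))"
        by (simp only: of_nat_le_iff)
      hence "real (card ?X) * ?s ^ ((d + 1) * T) \<le> ?p * (real (card S ^ (d + 1) - 1) ^ T * ?s ^ card I)"
        by simp
      also have "real (card S ^ (d + 1) - 1) = ?s ^ (d + 1) * (1 - 1 / ?s ^ (d + 1))"
      proof -
        have "1 \<le> card S ^ (d + 1)" using assms(1) by (intro one_le_power) simp
        hence "real (card S ^ (d + 1) - 1) = ?s ^ (d + 1) - 1" by (simp only: of_nat_diff of_nat_power of_nat_1)
        moreover have "z * (1 - 1 / z) = z - 1" if "z \<noteq> 0" for z :: real
          using that by (simp add: right_diff_distrib)
        moreover have "?s ^ (d + 1) \<noteq> 0" using spos by (intro power_not_zero) linarith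
        ultimately show ?thesis by metis
      qed
      also have "(\<dots>) ^ T = ?s ^ ((d + 1) * T) * (1 - 1 / ?s ^ (d + 1)) ^ T"
        by (simp only: power_mult_distrib power_mult)
      finally have "?s ^ ((d + 1) * T) * real (card ?X)
          \<le> ?s ^ ((d + 1) * T) * (?p * (1 - 1 / ?s ^ (d + 1)) ^ T * ?s ^ card I)"
        by (simp only: mult_ac)
      hence "real (card ?X) \<le> ?p * (1 - 1 / ?s ^ (d + 1)) ^ T * ?s ^ card I"
        using spos by (simp only: mult_le_cancel_left_pos zero_less_power)
      also have "\<dots> \<le> ?p * q ^ T * ?s ^ card I"
      proof (intro mult_right_mono mult_left_mono power_mono)
        show "0 \<le> 1 - 1 / ?s ^ (d + 1)"
          using assms(1) one_le_power[of ?s "d + 1"] by (simp add: divide_le_eq)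
      qed (auto simp: q_def)
      finally show ?thesis .
    qed
  qed
  thus ?thesis using q by blast
qed

text \<open>
  The condition on \<open>T\<close> reads \<open>T log T = O(log k)\<close>, so it allows \<open>T\<close> of order
  \<open>log k / log log k\<close>. This is the source of the exponent.
\<close>

lemma growth_bound:
  fixes p C :: nat and q :: real
  assumes "0 < q" "q < 1" "1 \<le> p"
  shows "\<exists>a k0. a > 0 \<and> k0 \<ge> 3 \<and> (\<forall>k\<ge>k0. \<exists>T.
    p ^ T * ((T + 1) * (C * T) * p) ^ (C * T) < k \<and>
    q ^ T \<le> 1 / q * real k powr (- a / ln (ln (real k))))"
proof -
  \<comment> \<open>With \<open>L = log k\<close>, the numbers \<open>p\<close>, \<open>C p\<close>, \<open>T\<close> and \<open>T + 1\<close> are at most \<open>L\<close>, so the left side is at most \<open>L ^ (T + 3 C T)\<close>; this \<open>c\<close> makes it at most the square root of \<open>k\<close>.\<close>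
  define c where "c = 1 / (2 * (1 + 3 * real C))"
  have c: "0 < c" "c \<le> 1 / 2" by (auto simp: c_def field_simps)
  define a where "a = - c * ln q"
  have a: "0 < a" using c assms by (simp add: a_def mult_pos_neg)
  define L0 where "L0 = 3 + real p + real C * real p"
  define k0 where "k0 = nat \<lceil>exp L0\<rceil> + 3"
  have "\<exists>T. p ^ T * ((T + 1) * (C * T) * p) ^ (C * T) < k \<and>
    q ^ T \<le> 1 / q * real k powr (- a / ln (ln (real k)))" if k: "k \<ge> k0" for k
  proof -
    define L where "L = ln (real k)"
    define l where "l = ln L"
    have "exp L0 \<le> real k" using k unfolding k0_def by linarith
    hence L0: "L0 \<le> L" unfolding L_def by (metis exp_gt_zero ln_exp ln_mono)
    have "0 \<le> real C * real p" "0 \<le> real p" by simp_all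
    hence L: "3 \<le> L" "real p \<le> L" "real C * real p \<le> L" using L0 unfolding L0_def by linarith+
    have expL: "exp L = real k" unfolding L_def using k by (simp add: k0_def)
    have expl: "exp l = L" unfolding l_def using L by simp
    have "exp 1 \<le> exp l" using exp_le L(1) unfolding expl by linarith
    hence l: "1 \<le> l" by simp
    define T where "T = nat \<lfloor>c * L / l\<rfloor>"
    have "0 \<le> c * L / l" using c L l by simp
    hence T: "real T \<le> c * L / l" "c * L / l - 1 \<le> real T" unfolding T_def by linarith+
    have "c * L * 1 \<le> c * L * l" using c L l by (intro mult_left_mono) auto
    hence "c * L / l \<le> c * L" using l by (simp add: divide_le_eq)
    also have "\<dots> \<le> 1 / 2 * L" using c L by (intro mult_right_mono) auto
    finally have TL: "real T + 1 \<le> L" using T L by linarith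
    have "real (p ^ T * ((T + 1) * (C * T) * p) ^ (C * T))
        = real p ^ T * ((real T + 1) * real T * (real C * real p)) ^ (C * T)"
      by (simp add: algebra_simps)
    also have "\<dots> \<le> L ^ T * (L * L * L) ^ (C * T)"
      using L TL by (intro mult_mono power_mono) auto
    also have "\<dots> = L ^ (T + 3 * (C * T))"
      by (simp add: power_add power_mult power3_eq_cube)
    also have "\<dots> = exp (l * real (T + 3 * (C * T)))"
      unfolding expl[symmetric] exp_of_nat_mult[symmetric] by (simp add: mult.commute expl)
    also have "\<dots> \<le> exp (L / 2)"
    proof -
      have "l * real (T + 3 * (C * T)) = l * (1 + 3 * real C) * real T" by (simp add: algebra_simps)
      also have "\<dots> \<le> l * (1 + 3 * real C) * (c * L / l)" using T l by (intro mult_left_mono) auto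
      also have "\<dots> = L / 2"
        using l unfolding c_def by (simp add: add_nonneg_eq_0_iff field_simps)
      finally show ?thesis by simp
    qed
    also have "\<dots> < exp L" using L by simp
    finally have "p ^ T * ((T + 1) * (C * T) * p) ^ (C * T) < k" unfolding expL of_nat_less_iff .
    moreover have "q ^ T \<le> 1 / q * real k powr (- a / ln (ln (real k)))"
    proof -
      have "q ^ T = q powr real T" using assms by (simp add: powr_realpow)
      also have "\<dots> \<le> q powr (c * L / l - 1)" using T assms by (intro powr_mono') auto
      also have "\<dots> = 1 / q * q powr (c * L / l)" using assms by (simp add: powr_diff)
      also have "q powr (c * L / l) = real k powr (- a / l)"
      proof -
        have "real k \<noteq> 0" using expL exp_gt_zero[of L] by linarith
        hence "real k powr (- a / l) = exp (- a / l * L)" by (simp add: powr_def L_def)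
        moreover have "q powr (c * L / l) = exp (c * L / l * ln q)" using assms by (simp add: powr_def)
        moreover have "c * L / l * ln q = - a / l * L" by (simp add: a_def)
        ultimately show ?thesis by (simp only:)
      qed
      finally show ?thesis by (simp add: l_def L_def)
    qed
    ultimately show ?thesis by blast
  qed
  thus ?thesis using a by (intro exI[of _ a] exI[of _ k0]) (auto simp: k0_def)
qed

theorem corollary1p5:
  fixes S :: "'p::prime_card mod_ring set" and r :: nat
  assumes "card S \<ge> 2"
    and "1 \<le> r" and "r \<le> CARD('p) - 1"
  shows "\<exists>a::real. a > 0 \<and>
    (\<exists>(C::real) (k0::nat). C > 0 \<and> k0 \<ge> 3 \<and>
      (\<forall>(k::nat) (n::nat) (E :: nat \<Rightarrow> 'p mod_ring set)
         (\<phi> :: nat \<Rightarrow> (nat \<Rightarrow> 'p mod_ring) \<Rightarrow> 'p mod_ring).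
        k \<ge> k0 \<longrightarrow> n \<ge> 1 \<longrightarrow>
        (\<forall>i\<in>{1..k}. E i \<subset> UNIV \<and> card (E i) \<le> r) \<longrightarrow>
        (\<forall>i\<in>{1..k}. linear_form n (\<phi> i)) \<longrightarrow>
        (\<forall>i j. 1 \<le> i \<and> i < j \<and> j \<le> k \<longrightarrow>
           card (form_support n (\<lambda>x. \<phi> j x - \<phi> i x)) \<ge> 2 * ((r - 1) div (card S - 1)) + 1) \<longrightarrow>
        density_in_power S n {x \<in> {1..n} \<rightarrow>\<^sub>E S. \<forall>i\<in>{1..k}. \<phi> i x \<in> E i}
          \<le> C * real k powr (- a / ln (ln (real k)))))"
proof -
  have r: "r < CARD('p)" using assms(2,3) by linarith
  let ?d = "(r - 1) div (card S - 1)" and ?p = "real CARD('p)"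
  from density_bound[OF assms(1,2) r, where 'i = nat]
  obtain q C where q: "0 < q" "q < 1" and bound:
    "\<forall>T (I :: nat set) K (M :: nat \<Rightarrow> nat \<Rightarrow> 'p mod_ring) E.
      finite I \<longrightarrow> finite K \<longrightarrow> (\<forall>k\<in>K. card (E k) \<le> r) \<longrightarrow>
      (\<forall>j\<in>K. \<forall>k\<in>K. j \<noteq> k \<longrightarrow> 2 * ?d + 1 \<le> card (supp I (\<lambda>i. M k i - M j i))) \<longrightarrow>
      CARD('p) ^ T * ((T + 1) * (C * T) * CARD('p)) ^ (C * T) < card K \<longrightarrow>
      real (card {x \<in> I \<rightarrow>\<^sub>E S. \<forall>k\<in>K. form I (M k) x \<in> E k})
        \<le> ?p * q ^ T * real (card S) ^ card I"
    by (elim exE conjE)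
  have "1 \<le> CARD('p)" using r by linarith
  from growth_bound[OF q this, of C]
  obtain a k0 where a: "a > 0" "k0 \<ge> 3" and growth: "\<forall>k\<ge>k0. \<exists>T.
    CARD('p) ^ T * ((T + 1) * (C * T) * CARD('p)) ^ (C * T) < k \<and>
    q ^ T \<le> 1 / q * real k powr (- a / ln (ln (real k)))"
    by (elim exE conjE)
  have main: "density_in_power S n {x \<in> {1..n} \<rightarrow>\<^sub>E S. \<forall>i\<in>{1..k}. \<phi> i x \<in> E i}
      \<le> ?p / q * real k powr (- a / ln (ln (real k)))"
    if k: "k \<ge> k0" and E: "\<forall>i\<in>{1..k}. E i \<subset> UNIV \<and> card (E i) \<le> r"
      and lin: "\<forall>i\<in>{1..k}. linear_form n (\<phi> i)"
      and sep: "\<forall>i j. 1 \<le> i \<and> i < j \<and> j \<le> k \<longrightarrow>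
           card (form_support n (\<lambda>x. \<phi> j x - \<phi> i x)) \<ge> 2 * ?d + 1"
    for k n and E :: "nat \<Rightarrow> 'p mod_ring set" and \<phi> :: "nat \<Rightarrow> (nat \<Rightarrow> 'p mod_ring) \<Rightarrow> 'p mod_ring"
  proof -
    let ?I = "{1..n}" and ?K = "{1..k}"
    have "\<forall>i\<in>?K. \<exists>c. \<forall>x \<in> ?I \<rightarrow>\<^sub>E UNIV. \<phi> i x = form ?I c x"
      using lin unfolding linear_form_def form_def .
    from bchoice[OF this] obtain M where
      "\<forall>i\<in>?K. \<forall>x \<in> ?I \<rightarrow>\<^sub>E UNIV. \<phi> i x = form ?I (M i) x" by (elim exE)
    hence M: "\<phi> i x = form ?I (M i) x" if "i \<in> ?K" "x \<in> ?I \<rightarrow>\<^sub>E UNIV" for i x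
      using that by blast
    have supp: "form_support n (\<lambda>x. \<phi> j x - \<phi> i x) = supp ?I (\<lambda>l. M j l - M i l)"
      if "i \<in> ?K" "j \<in> ?K" for i j
      unfolding supp_def
      by (rule form_support_eq)
        (use M that in \<open>auto simp: form_def algebra_simps sum_subtractf\<close>)
    have "2 * ?d + 1 \<le> card (supp ?I (\<lambda>l. M j l - M i l))" if "i \<in> ?K" "j \<in> ?K" "i \<noteq> j" for i j
    proof (cases "i < j")
      case True
      thus ?thesis using sep[rule_format, of i j] that supp[of i j] by auto
    next
      case False
      moreover have "supp ?I (\<lambda>l. M j l - M i l) = supp ?I (\<lambda>l. M i l - M j l)"
        by (auto simp: supp_def)
      ultimately show ?thesis using sep[rule_format, of j i] that supp[of j i] by auto
    qed
    moreover obtain T where T: "CARD('p) ^ T * ((T + 1) * (C * T) * CARD('p)) ^ (C * T) < k"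
      "q ^ T \<le> 1 / q * real k powr (- a / ln (ln (real k)))"
      using growth k by blast
    ultimately have "real (card {x \<in> ?I \<rightarrow>\<^sub>E S. \<forall>k\<in>?K. form ?I (M k) x \<in> E k})
        \<le> ?p * q ^ T * real (card S) ^ card ?I"
      using E by (intro bound[rule_format]) auto
    moreover have "{x \<in> ?I \<rightarrow>\<^sub>E S. \<forall>i\<in>?K. \<phi> i x \<in> E i} = {x \<in> ?I \<rightarrow>\<^sub>E S. \<forall>k\<in>?K. form ?I (M k) x \<in> E k}"
    proof -
      have "\<phi> i x = form ?I (M i) x" if "x \<in> ?I \<rightarrow>\<^sub>E S" "i \<in> ?K" for i x
        using that by (intro M) (auto simp: PiE_iff)
      thus ?thesis by auto
    qed
    ultimately have "density_in_power S n {x \<in> ?I \<rightarrow>\<^sub>E S. \<forall>i\<in>?K. \<phi> i x \<in> E i} \<le> ?p * q ^ T"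
      using assms(1) by (simp add: density_in_power_def divide_le_eq)
    also have "\<dots> \<le> ?p * (1 / q * real k powr (- a / ln (ln (real k))))"
      using T(2) by (intro mult_left_mono) auto
    finally show ?thesis by simp
  qed
  have "0 < ?p / q" using q by simp
  show ?thesis
    by (rule exI[of _ a], rule conjI[OF a(1)], rule exI[of _ "?p / q"], rule exI[of _ k0],
        intro conjI allI impI) (fact \<open>0 < ?p / q\<close> | fact a(2) | rule main; assumption)+
qed

end
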